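(* Let $p\in(-\infty,1]$ and let $\varepsilon>0$ be any fixed constant. For fair division instances $\langle [m],[n],\{v_i\}_{i=1}^n\rangle$ with XOS valuations, finding an allocation with $p$-mean welfare at least $1/n^{1-\varepsilon}$ times the optimal $p$-mean welfare requires exponentially many value queries.
   Context: A fair division instance $\langle [m],[n],\{v_i\}_{i=1}^n\rangle$ consists of a set $[m]=\{1,\ldots,m\}$ of indivisible goods, a set $[n]=\{1,\ldots,n\}$ of agents, and for each agent $i$ a valuation function $v_i:2^{[m]}\to\mathbb{R}_+$, assumed nonnegative, normalized ($v_i(\emptyset)=0$) and monotone ($v_i(A)\le v_i(B)$ for $A\subseteq B$). A valuation $v$ is XOS (fractionally subadditive) if there is a collection of additive functions $f_1,\ldots,f_L$ on subsets of $[m]$ ($L$ may be exponentially large in $m$) with $v(S)=\max_{1\le r\le L} f_r(S)$ for all $S\subseteq[m]$. An allocation is an $n$-partition $\mathcal{A}=(A_1,\ldots,A_n)$ of $[m]$, agent $i$ receiving $A_i$. The $p$-mean welfare of $\mathcal{A}$ is $\mathrm{M}_p(\mathcal{A})=\left(\frac1n\sum_{i=1}^n v_i(A_i)^p\right)^{1/p}$, read for $p=0$ as the limit, i.e. the geometric mean $\left(\prod_{i} v_i(A_i)\right)^{1/n}$ (the Nash social welfare), and read as $0$ when $p<0$ and some $v_i(A_i)=0$. The optimal $p$-mean welfare is the maximum of $\mathrm{M}_p(\mathcal{A})$ over all allocations $\mathcal{A}$. The valuations are accessed only through value queries: a value query consists of an agent $i$ and a set $S\subseteq[m]$ and returns $v_i(S)$.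 *)

theory Defs
  imports "HOL-Probability.Probability"
begin

text \<open>
  Goods are \<open>{1..m}\<close> and agents are \<open>{1..n}\<close>. Valuations and allocations are total functions,
  of which only the values at agents in \<open>{1..n}\<close> and subsets of \<open>{1..m}\<close> are meaningful.
\<close>

definition valuation :: "nat \<Rightarrow> (nat set \<Rightarrow> real) \<Rightarrow> bool" where
  "valuation m v \<longleftrightarrow>
     (\<forall>S\<subseteq>{1..m}. 0 \<le> v S) \<and> v {} = 0 \<and> (\<forall>A B. A \<subseteq> B \<and> B \<subseteq> {1..m} \<longrightarrow> v A \<le> v B)"

definition XOS :: "nat \<Rightarrow> (nat set \<Rightarrow> real) \<Rightarrow> bool" where
  "XOS m v \<longleftrightarrow>
     (\<exists>(L::nat) f. 1 \<le> L \<and> (\<forall>r\<in>{1..L}. additive (Pow {1..m}) (f r)) \<and>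
        (\<forall>S\<subseteq>{1..m}. v S = Max ((\<lambda>r. f r S) ` {1..L})))"

definition XOS_instance :: "nat \<Rightarrow> nat \<Rightarrow> (nat \<Rightarrow> nat set \<Rightarrow> real) \<Rightarrow> bool" where
  "XOS_instance n m v \<longleftrightarrow> (\<forall>i\<in>{1..n}. valuation m (v i) \<and> XOS m (v i))"

text \<open>Bundles may be empty, so this is not \<^const>\<open>partition_on\<close>.\<close>

definition allocation :: "nat \<Rightarrow> nat \<Rightarrow> (nat \<Rightarrow> nat set) \<Rightarrow> bool" where
  "allocation n m A \<longleftrightarrow> (\<Union>i\<in>{1..n}. A i) = {1..m} \<and> disjoint_family_on A {1..n}"

definition p_mean :: "real \<Rightarrow> nat \<Rightarrow> (nat \<Rightarrow> real) \<Rightarrow> real" where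
  "p_mean p n x =
     (if p = 0 then (\<Prod>i=1..n. x i) powr (1 / real n)
      else if p < 0 \<and> (\<exists>i\<in>{1..n}. x i = 0) then 0
      else ((1 / real n) * (\<Sum>i=1..n. x i powr p)) powr (1 / p))"

definition welfare ::
  "real \<Rightarrow> nat \<Rightarrow> (nat \<Rightarrow> nat set \<Rightarrow> real) \<Rightarrow> (nat \<Rightarrow> nat set) \<Rightarrow> real" where
  "welfare p n v A = p_mean p n (\<lambda>i. v i (A i))"

text \<open>
  The set of welfare values is finite, since the welfare of \<open>A\<close> depends only on the bundles
  \<open>A i\<close> with \<open>i \<in> {1..n}\<close>.
\<close>

definition optimal_welfare ::
  "real \<Rightarrow> nat \<Rightarrow> nat \<Rightarrow> (nat \<Rightarrow> nat set \<Rightarrow> real) \<Rightarrow> real" where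
  "optimal_welfare p n m v = Max {welfare p n v A |A. allocation n m A}"

text \<open>
  A deterministic adaptive algorithm in the value-query model is a decision tree: it either
  stops with an output or queries the value of a set for an agent and continues depending on
  the answer. Only queries are charged for, computation is free. A randomized algorithm is a
  probability distribution over such trees.
\<close>

datatype query_alg =
    Output "nat \<Rightarrow> nat set"
  | Query nat "nat set" "real \<Rightarrow> query_alg"

primrec wf_alg :: "nat \<Rightarrow> nat \<Rightarrow> query_alg \<Rightarrow> bool" where
  "wf_alg n m (Output A) \<longleftrightarrow> True"
| "wf_alg n m (Query i S k) \<longleftrightarrow> i \<in> {1..n} \<and> S \<subseteq> {1..m} \<and> (\<forall>y. wf_alg n m (k y))"

primrec result :: "query_alg \<Rightarrow> (nat \<Rightarrow> nat set \<Rightarrow> real) \<Rightarrow> (nat \<Rightarrow> nat set)" where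
  "result (Output A) v = A"
| "result (Query i S k) v = result (k (v i S)) v"

primrec num_queries :: "query_alg \<Rightarrow> (nat \<Rightarrow> nat set \<Rightarrow> real) \<Rightarrow> nat" where
  "num_queries (Output A) v = 0"
| "num_queries (Query i S k) v = Suc (num_queries (k (v i S)) v)"

definition approx_optimal ::
  "real \<Rightarrow> real \<Rightarrow> nat \<Rightarrow> nat \<Rightarrow> (nat \<Rightarrow> nat set \<Rightarrow> real) \<Rightarrow> (nat \<Rightarrow> nat set) \<Rightarrow> bool" where
  "approx_optimal p \<alpha> n m v A \<longleftrightarrow>
     allocation n m A \<and> \<alpha> * optimal_welfare p n m v \<le> welfare p n v A"

text \<open>
  \<open>solves p \<alpha> \<delta> n m R\<close>: on every XOS instance with \<open>n\<close> agents and \<open>m\<close> goods, the randomized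
  algorithm \<open>R\<close> outputs an \<open>\<alpha>\<close>-approximately optimal allocation with probability at least \<open>\<delta>\<close>.
  For \<open>\<delta> = 1\<close> and a point mass \<open>R\<close> this is correctness of a deterministic algorithm.
\<close>

definition solves ::
  "real \<Rightarrow> real \<Rightarrow> real \<Rightarrow> nat \<Rightarrow> nat \<Rightarrow> query_alg pmf \<Rightarrow> bool" where
  "solves p \<alpha> \<delta> n m R \<longleftrightarrow>
     (\<forall>T\<in>set_pmf R. wf_alg n m T) \<and>
     (\<forall>v. XOS_instance n m v \<longrightarrow>
        \<delta> \<le> measure_pmf.prob R {T. approx_optimal p \<alpha> n m v (result T v)})"

end

theory Submission
  imports Defs "HOL-Real_Asymp.Real_Asymp"
begin

text \<open>
  Take \<open>m = n\<^sup>3\<close> goods in \<open>n\<^sup>2\<close> blocks of \<open>n\<close>. A random cyclic shift in each block gives every agent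
  one good per block, hence a hidden bundle \<open>T\<^sub>i\<close> of size \<open>n\<^sup>2\<close>. With \<open>a = n powr (\<epsilon>/2 - 1)\<close>, the
  valuations \<open>max (min \<bar>S\<bar> n) (a\<bar>S\<bar>)\<close> and \<open>max (max (min \<bar>S\<bar> n) (a\<bar>S\<bar>)) \<bar>S \<inter> T\<^sub>i\<bar>\<close> differ at a fixed \<open>S\<close>
  only if \<open>\<bar>S \<inter> T\<^sub>i\<bar>\<close> exceeds both \<open>n\<close> and \<open>n powr (\<epsilon>/2)\<close> times its mean, which by a Chernoff bound
  happens for a fraction of at most \<open>exp (-n)\<close> of the shifts. So an algorithm with fewer than \<open>2^n\<close>
  queries sees only the first valuation and, for most shifts, its output is worth the same under
  both. As \<open>M\<^sub>p \<le> M\<^sub>1\<close>, that output has welfare at most \<open>n + n powr (1 + \<epsilon>/2)\<close>, while the hidden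
  bundles give every agent at least \<open>n\<^sup>2\<close>.
\<close>

section \<open>Power means and their comparison with the arithmetic mean\<close>

lemma p_mean_const:
  assumes "0 < n" and "0 < x"
  shows "p_mean p n (\<lambda>_. x) = x"
proof (cases "p = 0")
  case True
  then show ?thesis
    using assms by (simp add: p_mean_def powr_powr flip: powr_realpow)
next
  case False
  then show ?thesis
    using assms by (simp add: p_mean_def powr_powr)
qed

lemma p_mean_cong:
  assumes "\<And>i. i \<in> {1..n} \<Longrightarrow> x i = y i"
  shows "p_mean p n x = p_mean p n y"
proof -
  have "(\<exists>i\<in>{1..n}. x i = 0) \<longleftrightarrow> (\<exists>i\<in>{1..n}. y i = 0)"
    using assms by auto
  moreover have "(\<Prod>i=1..n. x i) = (\<Prod>i=1..n. y i)"
    using assms by (intro prod.cong) auto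
  moreover have "(\<Sum>i=1..n. x i powr p) = (\<Sum>i=1..n. y i powr p)"
    using assms by (intro sum.cong) auto
  ultimately show ?thesis
    by (simp only: p_mean_def)
qed

text \<open>Concavity: the tangent at 1 lies above the power. Its value \<open>u\<close> is the mean
  of \<open>t\<close> and 1 with weights \<open>p\<close> and \<open>1 - p\<close>; adding the
  weighted bounds \<open>ln s \<le> s - 1\<close> at \<open>s = t / u\<close> and
  \<open>s = 1 / u\<close> gives \<open>p * ln t \<le> ln u\<close>.\<close>

lemma powr_le_tangent:
  fixes t p :: real
  assumes "0 \<le> t" and "0 < p" and "p \<le> 1"
  shows "t powr p \<le> 1 + p * (t - 1)"
proof (cases "t = 0")
  case True
  then show ?thesis using assms by simp
next
  case False
  then have t: "0 < t" using assms by simp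
  define u where "u = 1 + p * (t - 1)"
  have "u = p * t + (1 - p)" by (simp add: u_def algebra_simps)
  moreover have "0 < p * t" using assms t by simp
  ultimately have u: "0 < u" using assms by linarith
  have "p * ln (t / u) + (1 - p) * ln (1 / u) \<le> p * (t / u - 1) + (1 - p) * (1 / u - 1)"
    using assms t u by (intro add_mono mult_left_mono ln_le_minus_one) auto
  also have "\<dots> = 0"
    using u by (simp add: field_simps) (simp add: u_def algebra_simps)
  finally have "p * ln t \<le> ln u"
    using t u by (simp add: ln_div algebra_simps)
  then have "exp (p * ln t) \<le> u"
    using u exp_le_cancel_iff[of "p * ln t" "ln u"] by (simp del: exp_le_cancel_iff)
  then show ?thesis
    using t by (simp add: powr_def u_def)
qed

lemma powr_ge_tangent:
  fixes t p :: real
  assumes "0 < t" and "p < 0"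
  shows "1 + p * (t - 1) \<le> t powr p"
proof -
  have "1 + p * (t - 1) \<le> 1 + p * ln t"
    using assms ln_le_minus_one[of t] by (simp add: mult_left_mono_neg)
  also have "\<dots> \<le> exp (p * ln t)" by (rule exp_ge_add_one_self)
  finally show ?thesis using assms by (simp add: powr_def)
qed

text \<open>After division by the arithmetic mean, each term is compared with its tangent at 1
  (logarithm for \<open>p = 0\<close>, power otherwise). The linear parts cancel in the sum.\<close>

lemma p_mean_le_arith_mean:
  assumes "p \<le> 1" and "0 < n" and x: "\<And>i. i \<in> {1..n} \<Longrightarrow> 0 \<le> x i"
  shows "p_mean p n x \<le> (\<Sum>i=1..n. x i) / real n"
proof -
  define \<mu> where "\<mu> = (\<Sum>i=1..n. x i) / real n"
  have sum_x: "(\<Sum>i=1..n. x i) = real n * \<mu>" using \<open>0 < n\<close> by (simp add: \<mu>_def)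
  have \<mu>0: "0 \<le> \<mu>" unfolding \<mu>_def using x by (intro divide_nonneg_nonneg sum_nonneg) auto
  have tangent_sum: "(\<Sum>i=1..n. 1 + c * (x i / \<mu> - 1)) = real n" if "\<mu> > 0" for c
  proof -
    have "(\<Sum>i=1..n. 1 + c * (x i / \<mu> - 1)) = real n + c * ((\<Sum>i=1..n. x i) / \<mu> - real n)"
      by (simp add: sum.distrib sum_subtractf sum_divide_distrib flip: sum_distrib_left)
    then show ?thesis using that sum_x by simp
  qed
  \<comment> \<open>In the first two cases the \<open>p\<close>-mean is 0. In the others division by
    \<open>\<mu>\<close> is possible, and for \<open>p \<le> 0\<close> all entries are
    positive.\<close>
  consider "\<mu> = 0" | "p \<le> 0" "\<exists>i\<in>{1..n}. x i = 0"
    | "0 < \<mu>" "p = 0" "\<And>i. i \<in> {1..n} \<Longrightarrow> 0 < x i"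
    | "0 < \<mu>" "p < 0" "\<And>i. i \<in> {1..n} \<Longrightarrow> 0 < x i" | "0 < \<mu>" "0 < p"
  proof -
    have "0 < x i" if "\<not> (\<exists>i\<in>{1..n}. x i = 0)" "i \<in> {1..n}" for i
      using x[OF that(2)] that by force
    moreover have "\<mu> = 0 \<or> 0 < \<mu>" "p < 0 \<or> p = 0 \<or> 0 < p" using \<mu>0 by auto
    ultimately show thesis using that less_imp_le[of p 0] by blast
  qed
  then have "p_mean p n x \<le> \<mu>"
  proof cases
    case 1
    then have "x i = 0" if "i \<in> {1..n}" for i
      using sum_x x that sum_nonneg_eq_0_iff[of "{1..n}" x] by auto
    then have "p_mean p n x = p_mean p n (\<lambda>_. 0)" by (intro p_mean_cong)
    then show ?thesis using 1 \<open>0 < n\<close> by (simp add: p_mean_def power_0_left)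
  next
    case 2
    then have "(\<Prod>i=1..n. x i) powr (1 / real n) = 0" by (simp add: prod_zero)
    then have "p_mean p n x = 0" using 2 unfolding p_mean_def by auto
    then show ?thesis using \<mu>0 by simp
  next
    case 3
    have "(\<Sum>i=1..n. ln (x i)) - real n * ln \<mu> = (\<Sum>i=1..n. ln (x i) - ln \<mu>)"
      by (simp add: sum_subtractf)
    also have "\<dots> = (\<Sum>i=1..n. ln (x i / \<mu>))"
      using 3 by (intro sum.cong refl ln_divide_pos[symmetric]) auto
    also have "\<dots> \<le> (\<Sum>i=1..n. x i / \<mu> - 1)"
      using 3 by (intro sum_mono ln_le_minus_one) auto
    also have "\<dots> = 0"
      using tangent_sum[of 1] 3 by (simp add: sum_subtractf)
    finally have "(\<Sum>i=1..n. ln (x i)) / real n \<le> ln \<mu>"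
      using \<open>0 < n\<close> by (simp add: field_simps)
    moreover have "0 < (\<Prod>i=1..n. x i)" using 3 by (intro prod_pos) auto
    moreover have "x i \<noteq> 0" if "i \<in> {1..n}" for i using 3(3)[OF that] by simp
    then have "ln (\<Prod>i=1..n. x i) = (\<Sum>i=1..n. ln (x i))"
      by (intro ln_prod) auto
    ultimately have "(\<Prod>i=1..n. x i) powr (1 / real n) \<le> exp (ln \<mu>)"
      by (simp add: powr_def del: exp_ln)
    then show ?thesis using 3 by (simp add: p_mean_def)
  next
    case 4
    have "real n = (\<Sum>i=1..n. 1 + p * (x i / \<mu> - 1))" using tangent_sum 4 by simp
    also have "\<dots> \<le> (\<Sum>i=1..n. (x i / \<mu>) powr p)"
      using 4 by (intro sum_mono powr_ge_tangent) auto
    also have "\<dots> = (\<Sum>i=1..n. x i powr p) / \<mu> powr p"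
      using 4 x by (simp add: powr_divide sum_divide_distrib)
    finally have "\<mu> powr p \<le> (\<Sum>i=1..n. x i powr p) / real n"
      using 4 \<open>0 < n\<close> by (simp add: field_simps)
    \<comment> \<open>The outer exponent \<open>1 / p\<close> is negative, so the lower bound on the
      average of powers becomes an upper bound on the mean.\<close>
    then have "((\<Sum>i=1..n. x i powr p) / real n) powr (1 / p) \<le> (\<mu> powr p) powr (1 / p)"
      using 4 by (intro powr_mono2') auto
    moreover have "x i \<noteq> 0" if "i \<in> {1..n}" for i using 4(3)[OF that] by simp
    ultimately show ?thesis using 4 by (auto simp: p_mean_def powr_powr)
  next
    case 5
    have "(\<Sum>i=1..n. x i powr p) / \<mu> powr p = (\<Sum>i=1..n. (x i / \<mu>) powr p)"
      using 5 x by (simp add: powr_divide sum_divide_distrib)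
    also have "\<dots> \<le> (\<Sum>i=1..n. 1 + p * (x i / \<mu> - 1))"
      using 5 x \<open>p \<le> 1\<close> by (intro sum_mono powr_le_tangent) auto
    also have "\<dots> = real n" using tangent_sum 5 by simp
    finally have "(\<Sum>i=1..n. x i powr p) / real n \<le> \<mu> powr p"
      using 5 \<open>0 < n\<close> by (simp add: field_simps)
    then have "((\<Sum>i=1..n. x i powr p) / real n) powr (1 / p) \<le> (\<mu> powr p) powr (1 / p)"
      using 5 by (intro powr_mono2) (auto intro!: divide_nonneg_nonneg sum_nonneg)
    then show ?thesis using 5 by (simp add: p_mean_def powr_powr)
  qed
  then show ?thesis by (simp add: \<mu>_def)
qed

section \<open>Exponential tail bound and averaging over a randomized algorithm\<close>

text \<open>Chernoff bound in counting form, with exponential moment parameter 2. The moment factors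
  over the coordinates, and \<open>1 + s \<le> exp s\<close> bounds its average by
  \<open>exp t\<close>; Markov's inequality at the threshold \<open>exp (2 * t)\<close> leaves
  \<open>exp (- t)\<close>.\<close>

lemma card_PiE_hits_le:
  fixes t :: real and G :: "'a \<Rightarrow> 'b set"
  assumes "finite B" and "finite J" and "J \<noteq> {}" and G: "\<And>b. b \<in> B \<Longrightarrow> G b \<subseteq> J"
    and t: "(exp 2 - 1) * real (\<Sum>b\<in>B. card (G b)) / real (card J) \<le> t"
  shows "real (card {h \<in> B \<rightarrow>\<^sub>E J. t \<le> real (card {b\<in>B. h b \<in> G b})})
           \<le> exp (- t) * real (card (B \<rightarrow>\<^sub>E J))"
proof -
  let ?H = "B \<rightarrow>\<^sub>E J"
  let ?X = "\<lambda>h. real (card {b\<in>B. h b \<in> G b})"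
  define w :: "'a \<Rightarrow> 'b \<Rightarrow> real" where "w b j = (if j \<in> G b then exp 2 else 1)" for b j
  have finH: "finite ?H" using assms by (intro finite_PiE) auto
  have J0: "0 < real (card J)" using assms by (simp add: card_gt_0_iff)
  have exp_X: "exp (2 * ?X h) = (\<Prod>b\<in>B. w b (h b))" for h
  proof -
    have "(\<Prod>b\<in>B. w b (h b)) = (\<Prod>b\<in>{b\<in>B. h b \<in> G b}. exp 2)"
      using \<open>finite B\<close> by (subst prod.inter_filter) (auto simp: w_def)
    then show ?thesis by (simp add: mult.commute flip: exp_of_nat_mult)
  qed
  have "real (card {h\<in>?H. t \<le> ?X h}) * exp (2 * t) = (\<Sum>h\<in>{h\<in>?H. t \<le> ?X h}. exp (2 * t))"
    by simp
  also have "\<dots> \<le> (\<Sum>h\<in>{h\<in>?H. t \<le> ?X h}. exp (2 * ?X h))"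
    by (intro sum_mono) auto
  also have "\<dots> \<le> (\<Sum>h\<in>?H. exp (2 * ?X h))"
    using finH by (intro sum_mono2) auto
  also have "\<dots> = (\<Prod>b\<in>B. \<Sum>j\<in>J. w b j)"
    using assms by (simp add: exp_X prod_sum_PiE)
  also have "\<dots> = (\<Prod>b\<in>B. real (card J) * (1 + (exp 2 - 1) * real (card (G b)) / real (card J)))"
  proof (intro prod.cong refl)
    fix b assume "b \<in> B"
    have "(\<Sum>j\<in>J. w b j) = (\<Sum>j\<in>J. 1 + (exp 2 - 1) * (if j \<in> G b then 1 else 0))"
      by (intro sum.cong) (auto simp: w_def)
    also have "\<dots> = real (card J) + (exp 2 - 1) * (\<Sum>j\<in>J. if j \<in> G b then 1 else 0)"
      by (simp add: sum.distrib flip: sum_distrib_left)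
    also have "(\<Sum>j\<in>J. if j \<in> G b then 1 else 0) = real (card (G b))"
      using \<open>finite J\<close> G[OF \<open>b \<in> B\<close>] by (simp add: sum.If_cases Int_absorb1)
    finally show "(\<Sum>j\<in>J. w b j)
        = real (card J) * (1 + (exp 2 - 1) * real (card (G b)) / real (card J))"
      using J0 by (simp add: distrib_left)
  qed
  also have "\<dots> \<le> (\<Prod>b\<in>B. real (card J) * exp ((exp 2 - 1) * real (card (G b)) / real (card J)))"
    using J0 by (intro prod_mono conjI mult_nonneg_nonneg mult_left_mono exp_ge_add_one_self) auto
  also have "\<dots> = real (card ?H) * exp ((exp 2 - 1) * real (\<Sum>b\<in>B. card (G b)) / real (card J))"
    using \<open>finite B\<close>
    by (simp add: prod.distrib card_PiE exp_sum sum_distrib_left sum_divide_distrib)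
  also have "\<dots> \<le> real (card ?H) * exp t"
    using t by (intro mult_left_mono) auto
  also have "exp t = exp (- t) * exp (2 * t)"
    by (simp flip: exp_add)
  finally show ?thesis
    by (simp flip: mult.assoc) (simp add: mult.commute)
qed

text \<open>The averaging half of Yao's principle: exchanging sum and expectation turns a bound on
  the instances that each single tree solves into one for the randomized algorithm.\<close>

lemma sum_prob_pmf_le:
  fixes B :: real
  assumes "finite H" and le: "\<And>T. T \<in> set_pmf R \<Longrightarrow> real (card {h\<in>H. P T h}) \<le> B"
  shows "(\<Sum>h\<in>H. measure_pmf.prob R {T. P T h}) \<le> B"
proof -
  have "(\<Sum>h\<in>H. measure_pmf.prob R {T. P T h})
      = measure_pmf.expectation R (\<lambda>T. \<Sum>h\<in>H. indicator {T. P T h} T)"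
    by (subst Bochner_Integration.integral_sum)
       (auto intro!: measure_pmf.integrable_const_bound[where B = 1])
  also have "\<dots> = measure_pmf.expectation R (\<lambda>T. real (card {h\<in>H. P T h}))"
    using \<open>finite H\<close> by (simp add: indicator_def of_bool_def sum.If_cases Int_def conj_commute)
  also have "\<dots> \<le> B"
    using le \<open>finite H\<close>
    by (intro measure_pmf.integral_le_const measure_pmf.integrable_const_bound[where B = "real (card H)"])
       (auto simp: AE_measure_pmf_iff intro!: card_mono)
  finally show ?thesis .
qed

section \<open>Query transcripts and the optimal welfare\<close>

primrec queries :: "query_alg \<Rightarrow> (nat \<Rightarrow> nat set \<Rightarrow> real) \<Rightarrow> (nat \<times> nat set) list" where
  "queries (Output A) v = []"
| "queries (Query i S k) v = (i, S) # queries (k (v i S)) v"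

lemma length_queries: "length (queries T v) = num_queries T v"
  by (induction T) auto

lemma queries_wf:
  assumes "wf_alg n m T" and "(i, S) \<in> set (queries T v)"
  shows "i \<in> {1..n} \<and> S \<subseteq> {1..m}"
  using assms
proof (induction T)
  case (Query j U k)
  then show ?case using Query.IH[of "k (v j U)"] by auto
qed simp

text \<open>Equal answers along the path of \<open>v\<close> keep \<open>w\<close> on the same path,
  so agreement off that path is irrelevant even though queries are adaptive.\<close>

lemma result_eq_if_queries_agree:
  assumes "\<And>i S. (i, S) \<in> set (queries T v) \<Longrightarrow> w i S = v i S"
  shows "result T w = result T v"
  using assms by (induction T) auto

lemma optimal_welfare_ge:
  assumes "allocation n m A"
  shows "welfare p n v A \<le> optimal_welfare p n m v"
  unfolding optimal_welfare_def
proof (rule Max_ge)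
  \<comment> \<open>Allocations are total functions, so there are infinitely many; restricting them
    to the agents leaves a finite function space with the same welfare values.\<close>
  have "{welfare p n v A |A. allocation n m A}
      \<subseteq> welfare p n v ` ({1..n} \<rightarrow>\<^sub>E Pow {1..m})"
  proof safe
    fix A assume A: "allocation n m A"
    have "welfare p n v A = welfare p n v (restrict A {1..n})"
      unfolding welfare_def by (rule p_mean_cong) simp
    moreover have "restrict A {1..n} \<in> {1..n} \<rightarrow>\<^sub>E Pow {1..m}"
      using A by (auto simp: allocation_def)
    ultimately show "welfare p n v A \<in> welfare p n v ` ({1..n} \<rightarrow>\<^sub>E Pow {1..m})"
      by blast
  qed
  then show "finite {welfare p n v A |A. allocation n m A}"
    by (rule finite_subset) (intro finite_imageI finite_PiE, auto)
qed (use assms in blast)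

section \<open>XOS valuations with a planted bundle\<close>

lemma XOS_if_Max_additive:
  assumes "finite F" and "F \<noteq> {}" and "\<And>f. f \<in> F \<Longrightarrow> additive (Pow {1..m}) f"
    and "\<And>S. S \<subseteq> {1..m} \<Longrightarrow> v S = Max ((\<lambda>f. f S) ` F)"
  shows "XOS m v"
proof -
  obtain f where f: "bij_betw f {1..card F} F"
    using ex_bij_betw_nat_finite_1[OF \<open>finite F\<close>] by blast
  then have F: "F = f ` {1..card F}" by (simp add: bij_betw_def)
  have "1 \<le> card F" using assms by (simp add: Suc_le_eq card_gt_0_iff)
  moreover have "\<forall>r\<in>{1..card F}. additive (Pow {1..m}) (f r)"
    using assms(3) F by blast
  moreover have "v S = Max ((\<lambda>r. f r S) ` {1..card F})" if "S \<subseteq> {1..m}" for S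
    using assms(4)[OF that] by (subst (asm) F) (simp add: image_image)
  ultimately show ?thesis unfolding XOS_def by blast
qed

text \<open>\<open>T = {}\<close> gives the unplanted valuation. Since \<open>T\<close> enters
  through a maximum, it stays invisible at every \<open>S\<close> where the other two terms
  dominate.\<close>

definition planted :: "nat \<Rightarrow> real \<Rightarrow> nat set \<Rightarrow> nat set \<Rightarrow> real" where
  "planted k a T S =
     max (max (real (min (card S) k)) (a * real (card S))) (real (card (S \<inter> T)))"

lemma planted_valuation:
  assumes "0 \<le> a"
  shows "valuation m (planted k a T)"
  unfolding valuation_def
proof (intro conjI allI impI)
  fix A B :: "nat set" assume AB: "A \<subseteq> B \<and> B \<subseteq> {1..m}"
  then have "finite B" using finite_subset by blast
  then have "card A \<le> card B" "card (A \<inter> T) \<le> card (B \<inter> T)"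
    using AB by (auto intro!: card_mono)
  then show "planted k a T A \<le> planted k a T B"
    unfolding planted_def using assms by (intro max.mono mult_left_mono) auto
qed (auto simp: planted_def)

lemma additive_card_Int: "additive (Pow {1..m::nat}) (\<lambda>S. real (card (S \<inter> W)))"
  unfolding additive_def
proof (intro ballI impI)
  fix A B assume "A \<in> Pow {1..m}" "B \<in> Pow {1..m}" and disj: "A \<inter> B = {}"
  then have "finite (A \<inter> W)" "finite (B \<inter> W)"
    by (auto intro: finite_subset)
  moreover have "(A \<inter> W) \<inter> (B \<inter> W) = {}" using disj by blast
  ultimately show "real (card ((A \<union> B) \<inter> W)) = real (card (A \<inter> W)) + real (card (B \<inter> W))"
    unfolding Int_Un_distrib2 by (subst card_Un_disjoint) simp_all
qed

text \<open>The capped cardinality is itself a maximum of additive functions, namely of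
  \<open>card (S \<inter> W)\<close> over all \<open>W\<close> with at most \<open>k\<close> goods.
  The remaining two terms are additive already.\<close>

lemma planted_XOS: "XOS m (planted k a T)"
proof -
  define Ws where "Ws = insert T {W. W \<subseteq> {1..m} \<and> card W \<le> k}"
  define F where "F = insert (\<lambda>S. a * real (card S)) ((\<lambda>W S. real (card (S \<inter> W))) ` Ws)"
  have "finite Ws" by (simp add: Ws_def)
  show ?thesis
  proof (rule XOS_if_Max_additive)
    show fin: "finite F" and "F \<noteq> {}" using \<open>finite Ws\<close> by (simp_all add: F_def)
    have "additive (Pow {1..m}) (\<lambda>S. a * real (card S))"
      using additive_card_Int[of m UNIV] by (simp add: additive_def distrib_left)
    then show "additive (Pow {1..m}) f" if "f \<in> F" for f
      using that additive_card_Int by (auto simp: F_def)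
    fix S assume S: "S \<subseteq> {1..m}"
    then have finS: "finite S" using finite_subset by blast
    obtain W where W: "W \<subseteq> S" "card W = min (card S) k"
      using obtain_subset_with_card_n[of "min (card S) k" S] by auto
    then have "real (min (card S) k) = real (card (S \<inter> W))"
      by (simp only: Int_absorb1)
    moreover have "(\<lambda>S. real (card (S \<inter> W))) \<in> F"
      using W S by (auto simp: F_def Ws_def)
    ultimately have attained: "real (min (card S) k) \<in> (\<lambda>f. f S) ` F"
      by (rule image_eqI)
    have small: "card (S \<inter> W) \<le> min (card S) k" if "W \<subseteq> {1..m}" "card W \<le> k" for W
      using that finS card_mono[of S "S \<inter> W"] card_mono[of W "S \<inter> W"] finite_subset[of W "{1..m}"]
      by auto
    show "planted k a T S = Max ((\<lambda>f. f S) ` F)"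
    proof (rule Max_eqI[symmetric])
      show "finite ((\<lambda>f. f S) ` F)" using fin by simp
      have "a * real (card S) \<in> (\<lambda>f. f S) ` F" "real (card (S \<inter> T)) \<in> (\<lambda>f. f S) ` F"
        by (auto simp: F_def Ws_def)
      then show "planted k a T S \<in> (\<lambda>f. f S) ` F"
        using attained unfolding planted_def max_def by (auto split: if_splits)
      fix y assume "y \<in> (\<lambda>f. f S) ` F"
      then consider "y = a * real (card S)" | "y = real (card (S \<inter> T))"
        | W where "W \<subseteq> {1..m}" "card W \<le> k" "y = real (card (S \<inter> W))"
        by (auto simp: F_def Ws_def)
      then show "y \<le> planted k a T S"
      proof cases
        case 3
        then have "y \<le> real (min (card S) k)" using small by simp
        then show ?thesis by (simp add: planted_def)
      qed (simp_all add: planted_def)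
    qed
  qed
qed

lemma planted_XOS_instance:
  assumes "0 \<le> a"
  shows "XOS_instance n m (\<lambda>i. planted k a (T i))"
  using assms by (simp add: XOS_instance_def planted_valuation planted_XOS)

section \<open>Hidden allocations from cyclic shifts\<close>

text \<open>\<open>e\<close> numbers the goods by block and position, and \<open>h b\<close> is the
  shift in block \<open>b\<close>. For fixed \<open>h\<close> the agents get disjoint bundles, while
  for fixed \<open>i\<close> the positions are independent and uniform when \<open>h\<close>
  is.\<close>

definition hidden_bundle :: "(nat \<times> nat \<Rightarrow> nat) \<Rightarrow> nat \<Rightarrow> nat \<Rightarrow> (nat \<Rightarrow> nat) \<Rightarrow> nat \<Rightarrow> nat set" where
  "hidden_bundle e l n h i = (\<lambda>b. e (b, (i + h b) mod n)) ` {..<l}"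

lemma inj_on_shift_mod: "inj_on (\<lambda>j. (i + j) mod n) {..<n::nat}"
proof (rule inj_onI)
  fix j k assume jk: "j \<in> {..<n}" "k \<in> {..<n}" "(i + j) mod n = (i + k) mod n"
  then have "(int i + int j) mod int n = (int i + int k) mod int n"
    by (simp flip: of_nat_add of_nat_mod)
  then have "int j mod int n = int k mod int n"
    by (metis add_diff_cancel_left' mod_diff_left_eq)
  then show "j = k" using jk by simp
qed

lemma allocation_hidden_bundle:
  assumes e: "bij_betw e ({..<l} \<times> {..<n}) {1..m}" and "0 < n"
  shows "allocation n m (hidden_bundle e l n h)"
proof -
  have inj: "inj_on e ({..<l} \<times> {..<n})" and im: "e ` ({..<l} \<times> {..<n}) = {1..m}"
    using e by (auto simp: bij_betw_def)
  have inj_agents: "inj_on (\<lambda>i. (i + c) mod n) {1..n}" for c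
  proof -
    \<comment> \<open>Agents are counted from 1 and positions from 0; the extra 1 is absorbed into
      the shift \<open>Suc c\<close>.\<close>
    have "{1..n} = Suc ` {..<n}" by (simp add: image_Suc_lessThan)
    moreover have "inj_on ((\<lambda>i. (i + c) mod n) \<circ> Suc) {..<n}"
      using inj_on_shift_mod[of "Suc c" n] by (simp add: comp_def add.commute)
    ultimately show ?thesis by (simp add: comp_inj_on_iff)
  qed
  have surj_agents: "(\<lambda>i. (i + c) mod n) ` {1..n} = {..<n}" for c
    using \<open>0 < n\<close> by (intro card_subset_eq) (auto simp: card_image[OF inj_agents[simplified]])
  have "(\<Union>i\<in>{1..n}. hidden_bundle e l n h i) = e ` ({..<l} \<times> {..<n})"
  proof (intro equalityI subsetI)
    fix x assume "x \<in> e ` ({..<l} \<times> {..<n})"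
    then obtain b j where x: "x = e (b, j)" "b < l" "j \<in> {..<n}" by auto
    then obtain i where "i \<in> {1..n}" "j = (i + h b) mod n"
      using surj_agents[of "h b"] by blast
    then show "x \<in> (\<Union>i\<in>{1..n}. hidden_bundle e l n h i)"
      using x by (auto simp: hidden_bundle_def)
  qed (use \<open>0 < n\<close> in \<open>auto simp: hidden_bundle_def\<close>)
  moreover have "hidden_bundle e l n h i \<inter> hidden_bundle e l n h i' = {}"
    if i: "i \<in> {1..n}" "i' \<in> {1..n}" "i \<noteq> i'" for i i'
  proof -
    have False if b: "b < l" "b' < l" "e (b, (i + h b) mod n) = e (b', (i' + h b') mod n)" for b b'
    proof -
      have "(b, (i + h b) mod n) = (b', (i' + h b') mod n)"
        using b \<open>0 < n\<close> by (intro inj_onD[OF inj]) auto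
      then have "b = b'" and "(i + h b') mod n = (i' + h b') mod n" by auto
      then have "i = i'" using i by - (rule inj_onD[OF inj_agents[of "h b'"]])
      then show False using i by simp
    qed
    then show ?thesis unfolding hidden_bundle_def by blast
  qed
  ultimately show ?thesis by (simp add: allocation_def disjoint_family_on_def im)
qed

lemma card_hidden_bundle:
  assumes e: "bij_betw e ({..<l} \<times> {..<n}) {1..m}" and "0 < n"
  shows "card (hidden_bundle e l n h i) = l"
proof -
  have "inj_on (\<lambda>b. e (b, (i + h b) mod n)) {..<l}"
  proof (rule inj_onI)
    fix b b' assume "b \<in> {..<l}" "b' \<in> {..<l}" "e (b, (i + h b) mod n) = e (b', (i + h b') mod n)"
    then have "(b, (i + h b) mod n) = (b', (i + h b') mod n)"
      using e \<open>0 < n\<close> by (auto simp: bij_betw_def dest!: inj_onD)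
    then show "b = b'" by simp
  qed
  then show ?thesis by (simp add: hidden_bundle_def card_image)
qed

section \<open>Rarity of the shifts that a single query detects\<close>

text \<open>The good of agent \<open>i\<close> in block \<open>b\<close> lies in \<open>S\<close>
  iff \<open>h b\<close> is in \<open>G b\<close>. The sets \<open>G b\<close> have total size at
  most \<open>card S\<close>, so the mean number of hits is at most \<open>card S / n\<close>; as
  \<open>a * n \<ge> exp 2\<close>, the tail bound applies at the threshold \<open>t\<close>, which
  is at least \<open>n\<close>.\<close>

lemma card_distinguishing_shifts_le:
  assumes e: "bij_betw e ({..<l} \<times> {..<n}) {1..m}" and "0 < n" and S: "S \<subseteq> {1..m}"
    and a: "exp 2 \<le> a * real n"
  shows "real (card {h \<in> {..<l} \<rightarrow>\<^sub>E {..<n}.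
             planted n a (hidden_bundle e l n h i) S \<noteq> planted n a {} S})
           \<le> exp (- real n) * real (card ({..<l} \<rightarrow>\<^sub>E {..<n}))"
proof -
  define G where "G b = {j. j < n \<and> e (b, (i + j) mod n) \<in> S}" for b
  define t where "t = max (real n) (a * real (card S))"
  have finS: "finite S" using S finite_subset by blast
  \<comment> \<open>Distinct pairs of block and shift name distinct goods, so these pairs inject
    into \<open>S\<close>.\<close>
  have "(\<Sum>b<l. card (G b)) = card (Sigma {..<l} G)"
    by (subst card_SigmaI) (auto simp: G_def)
  also have "\<dots> \<le> card S"
  proof (rule card_inj_on_le[of "\<lambda>(b, j). e (b, (i + j) mod n)"])
    show "inj_on (\<lambda>(b, j). e (b, (i + j) mod n)) (Sigma {..<l} G)"
    proof (rule inj_onI, clarsimp)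
      fix b j b' j'
      assume *: "b < l" "b' < l" "j \<in> G b" "j' \<in> G b'"
        "e (b, (i + j) mod n) = e (b', (i + j') mod n)"
      then have "(b, (i + j) mod n) = (b', (i + j') mod n)"
        using e \<open>0 < n\<close> by (auto simp: bij_betw_def dest!: inj_onD)
      then show "b = b' \<and> j = j'"
        using inj_on_shift_mod[of i n] * by (auto simp: G_def dest!: inj_onD)
    qed
  qed (use finS in \<open>auto simp: G_def\<close>)
  finally have sum_G: "(\<Sum>b<l. card (G b)) \<le> card S" .
  have "0 < a * real n" using a exp_gt_zero[of "2::real"] by linarith
  then have "(exp 2 - 1) * real (\<Sum>b<l. card (G b)) / real n \<le> (a * real n) * real (card S) / real n"
    using sum_G a \<open>0 < n\<close>
    by (intro divide_right_mono mult_mono) (auto simp flip: of_nat_sum)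
  also have "\<dots> \<le> t" using \<open>0 < n\<close> by (simp add: t_def)
  finally have t: "(exp 2 - 1) * real (\<Sum>b<l. card (G b)) / real n \<le> t" .
  have hits: "t \<le> real (card {b\<in>{..<l}. h b \<in> G b})"
    if h: "h \<in> {..<l} \<rightarrow>\<^sub>E {..<n}"
      and ne: "planted n a (hidden_bundle e l n h i) S \<noteq> planted n a {} S" for h
  proof -
    let ?X = "card (S \<inter> hidden_bundle e l n h i)"
    have X: "real (min (card S) n) < real ?X" "a * real (card S) < real ?X"
      using ne by (auto simp: planted_def max_def split: if_splits)
    \<comment> \<open>This excludes that the minimum in \<open>X\<close> is \<open>card S\<close>,
      so the intersection has more than \<open>n\<close> goods.\<close>
    moreover have "?X \<le> card S" using finS by (intro card_mono) auto
    ultimately have "t \<le> real ?X" by (auto simp: t_def)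
    also have "S \<inter> hidden_bundle e l n h i
        \<subseteq> (\<lambda>b. e (b, (i + h b) mod n)) ` {b\<in>{..<l}. h b \<in> G b}"
      using h by (auto simp: hidden_bundle_def G_def)
    then have "?X \<le> card {b\<in>{..<l}. h b \<in> G b}"
      by (intro surj_card_le) auto
    finally show ?thesis by simp
  qed
  have fin: "finite ({..<l} \<rightarrow>\<^sub>E {..<n})" by (intro finite_PiE) auto
  have "real (card {h \<in> {..<l} \<rightarrow>\<^sub>E {..<n}.
             planted n a (hidden_bundle e l n h i) S \<noteq> planted n a {} S})
      \<le> real (card {h \<in> {..<l} \<rightarrow>\<^sub>E {..<n}. t \<le> real (card {b\<in>{..<l}. h b \<in> G b})})"
    using hits fin by (intro of_nat_mono card_mono) auto
  also have "\<dots> \<le> exp (- t) * real (card ({..<l} \<rightarrow>\<^sub>E {..<n}))"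
    using t \<open>0 < n\<close> by (intro card_PiE_hits_le) (auto simp: G_def)
  also have "\<dots> \<le> exp (- real n) * real (card ({..<l} \<rightarrow>\<^sub>E {..<n}))"
    by (intro mult_right_mono) (auto simp: t_def)
  finally show ?thesis .
qed

section \<open>The welfare gap and the success of a single tree\<close>

text \<open>The arithmetic mean dominates, the maximum is at most the sum of its terms, and the
  bundle sizes add up to \<open>m\<close>.\<close>

lemma welfare_without_planted_le:
  assumes "p \<le> 1" and "0 < n" and "0 \<le> a" and A: "allocation n m A"
  shows "welfare p n (\<lambda>_. planted k a {}) A \<le> real k + a * real m / real n"
proof -
  have fin: "finite (A i)" if "i \<in> {1..n}" for i
    using A that by (intro finite_subset[of "A i" "{1..m}"]) (auto simp: allocation_def)
  have "card {1..m} = card (\<Union>i\<in>{1..n}. A i)"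
    using A by (simp add: allocation_def)
  also have "\<dots> = (\<Sum>i=1..n. card (A i))"
    using A fin by (intro card_UN_disjoint) (auto simp: allocation_def disjoint_family_on_def)
  finally have m: "real m = (\<Sum>i=1..n. real (card (A i)))" by simp
  have "welfare p n (\<lambda>_. planted k a {}) A \<le> (\<Sum>i=1..n. planted k a {} (A i)) / real n"
    unfolding welfare_def using assms by (intro p_mean_le_arith_mean) (auto simp: planted_def)
  also have "\<dots> \<le> (\<Sum>i=1..n. real k + a * real (card (A i))) / real n"
    using \<open>0 \<le> a\<close>
    by (intro divide_right_mono sum_mono) (auto simp: planted_def intro: add_increasing2)
  also have "\<dots> = real k + a * real m / real n"
    using \<open>0 < n\<close> by (simp add: sum.distrib m field_simps flip: sum_distrib_left)
  finally show ?thesis .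
qed

text \<open>The hidden allocation gives all agents the same value \<open>x \<ge> l\<close>, so its
  \<open>p\<close>-mean is \<open>x\<close> for every \<open>p\<close>.\<close>

lemma optimal_welfare_planted_ge:
  assumes e: "bij_betw e ({..<l} \<times> {..<n}) {1..m}" and "0 < n" and "0 < l"
  shows "real l \<le> optimal_welfare p n m (\<lambda>i. planted k a (hidden_bundle e l n h i))"
proof -
  let ?v = "\<lambda>i. planted k a (hidden_bundle e l n h i)"
  define x where "x = max (max (real (min l k)) (a * real l)) (real l)"
  have "welfare p n ?v (hidden_bundle e l n h) = p_mean p n (\<lambda>_. x)"
    unfolding welfare_def x_def planted_def using card_hidden_bundle[OF e \<open>0 < n\<close>] by simp
  also have "\<dots> = x" using assms by (intro p_mean_const) (auto simp: x_def)
  finally have "x \<le> optimal_welfare p n m ?v"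
    using optimal_welfare_ge[OF allocation_hidden_bundle[OF e \<open>0 < n\<close>, of h], of p ?v] by simp
  then show ?thesis by (simp add: x_def)
qed

text \<open>Run the tree on the unplanted instance. If \<open>h\<close> changes no value recorded in
  \<open>Q\<close>, the output and its welfare stay the same, and \<open>gap\<close> rules out
  success. A union bound over \<open>Q\<close> counts the other shifts.\<close>

lemma card_successful_shifts_le:
  fixes e l n a p \<alpha>
  defines "w \<equiv> \<lambda>h i. planted n a (hidden_bundle e l n h i)"
  assumes e: "bij_betw e ({..<l} \<times> {..<n}) {1..m}" and "0 < n" and "0 < l" and "p \<le> 1"
    and a: "exp 2 \<le> a * real n"
    and gap: "real n + a * real m / real n < \<alpha> * real l" and "0 \<le> \<alpha>"
    and T: "wf_alg n m T"
  shows "real (card {h \<in> {..<l} \<rightarrow>\<^sub>E {..<n}. approx_optimal p \<alpha> n m (w h) (result T (w h))})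
           \<le> (real (num_queries T (\<lambda>_. planted n a {})) + real n)
             * (exp (- real n) * real (card ({..<l} \<rightarrow>\<^sub>E {..<n})))"
proof -
  let ?H = "{..<l} \<rightarrow>\<^sub>E {..<n}"
  define v where "v = (\<lambda>_::nat. planted n a {})"
  define A where "A = result T v"
  \<comment> \<open>The output bundles are included because their values need not have been queried.
    The filter on \<open>A i\<close> covers trees whose output is not an allocation.\<close>
  define Q where "Q = set (queries T v) \<union> (\<lambda>i. (i, A i)) ` {i \<in> {1..n}. A i \<subseteq> {1..m}}"
  define D where "D = (\<lambda>(i, S). {h\<in>?H. w h i S \<noteq> v i S})"
  have finH: "finite ?H" by (intro finite_PiE) auto
  have "0 < a * real n" using a exp_gt_zero[of "2::real"] by linarith
  then have "0 \<le> a" using \<open>0 < n\<close> by (simp add: zero_less_mult_iff)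
  have "finite Q" by (simp add: Q_def)
  have "card Q \<le> card (set (queries T v)) + card ((\<lambda>i. (i, A i)) ` {i \<in> {1..n}. A i \<subseteq> {1..m}})"
    unfolding Q_def by (rule card_Un_le)
  also have "\<dots> \<le> num_queries T v + card {1..n}"
    by (intro add_mono surj_card_le[of "{1..n}" _ "\<lambda>i. (i, A i)"])
       (auto simp flip: length_queries intro: card_length)
  finally have card_Q: "card Q \<le> num_queries T v + n" by simp
  have "{h\<in>?H. approx_optimal p \<alpha> n m (w h) (result T (w h))} \<subseteq> (\<Union>q\<in>Q. D q)"
  proof (rule subsetI, rule ccontr)
    fix h assume h: "h \<in> {h\<in>?H. approx_optimal p \<alpha> n m (w h) (result T (w h))}"
      and "h \<notin> (\<Union>q\<in>Q. D q)"
    then have agree: "w h i S = v i S" if "(i, S) \<in> Q" for i S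
      using that by (fastforce simp: D_def)
    then have "result T (w h) = A"
      unfolding A_def by (intro result_eq_if_queries_agree) (auto simp: Q_def)
    then have alloc: "allocation n m A"
      and approx: "\<alpha> * optimal_welfare p n m (w h) \<le> welfare p n (w h) A"
      using h by (auto simp: approx_optimal_def)
    have "\<alpha> * real l \<le> \<alpha> * optimal_welfare p n m (w h)"
      using optimal_welfare_planted_ge[OF e \<open>0 < n\<close> \<open>0 < l\<close>] \<open>0 \<le> \<alpha>\<close>
      unfolding w_def by (intro mult_left_mono)
    also note approx
    also have "welfare p n (w h) A = welfare p n v A"
      unfolding welfare_def
    proof (intro p_mean_cong agree)
      fix i assume "i \<in> {1..n}"
      moreover from this have "A i \<subseteq> {1..m}" using alloc by (auto simp: allocation_def)
      ultimately show "(i, A i) \<in> Q" by (simp add: Q_def)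
    qed
    also have "\<dots> \<le> real n + a * real m / real n"
      using welfare_without_planted_le[OF \<open>p \<le> 1\<close> \<open>0 < n\<close> \<open>0 \<le> a\<close> alloc] by (simp add: v_def)
    finally show False using gap by simp
  qed
  then have "card {h\<in>?H. approx_optimal p \<alpha> n m (w h) (result T (w h))} \<le> card (\<Union>q\<in>Q. D q)"
    using \<open>finite Q\<close> finH by (intro card_mono) (auto simp: D_def)
  also have "\<dots> \<le> (\<Sum>q\<in>Q. card (D q))"
    using \<open>finite Q\<close> by (rule card_UN_le)
  finally have "real (card {h\<in>?H. approx_optimal p \<alpha> n m (w h) (result T (w h))})
      \<le> (\<Sum>q\<in>Q. real (card (D q)))"
    by (simp flip: of_nat_sum)
  also have "\<dots> \<le> (\<Sum>q\<in>Q. exp (- real n) * real (card ?H))"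
  proof (intro sum_mono)
    fix q assume "q \<in> Q"
    moreover obtain i S where q: "q = (i, S)" by (cases q)
    ultimately have "S \<subseteq> {1..m}" using queries_wf[OF T] by (auto simp: Q_def)
    then show "real (card (D q)) \<le> exp (- real n) * real (card ?H)"
      using card_distinguishing_shifts_le[OF e \<open>0 < n\<close> _ a, of S i]
      by (simp add: q D_def w_def v_def)
  qed
  also have "\<dots> \<le> (real (num_queries T v) + real n) * (exp (- real n) * real (card ?H))"
    using card_Q by (simp only: sum_constant flip: of_nat_add) (intro mult_right_mono, auto)
  finally show ?thesis by (simp add: v_def)
qed

section \<open>Choice of parameters and the bound for randomized algorithms\<close>

theorem theorem10:
  fixes p \<epsilon> \<delta> :: real
  assumes "p \<le> 1" and "0 < \<epsilon>" and "0 < \<delta>"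
  shows "\<exists>c>0. \<exists>(d::nat) (N::nat). \<forall>n\<ge>N. \<exists>m\<le>n ^ d. \<forall>R.
           solves p (1 / real n powr (1 - \<epsilon>)) \<delta> n m R \<longrightarrow>
           (\<exists>v. XOS_instance n m v \<and>
              (\<exists>T\<in>set_pmf R. 2 powr (c * real n) \<le> real (num_queries T v)))"
proof -
  have exp_lim: "(\<lambda>n::nat. exp (- c * real n)) \<longlonglongrightarrow> 0" if "0 < c" for c
    using that by real_asymp
  \<comment> \<open>This is \<open>2 powr n * exp (- n)\<close>: since \<open>ln 2 < 1\<close>, the
    union bound survives \<open>2 powr n\<close> queries, which permits
    \<open>c = 1\<close>.\<close>
  have "(\<lambda>n::nat. exp (- (1 - ln 2) * real n)) \<longlonglongrightarrow> 0"
    using ln_2_less_1 by (intro exp_lim) simp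
  moreover have "(\<lambda>n::nat. real n * exp (- real n)) \<longlonglongrightarrow> 0"
    by real_asymp
  ultimately have "(\<lambda>n::nat. exp (- (1 - ln 2) * real n) + real n * exp (- real n)) \<longlonglongrightarrow> 0 + 0"
    by (rule tendsto_add)
  then have "(\<lambda>n::nat. (2 powr real n + real n) * exp (- real n)) \<longlonglongrightarrow> 0"
    by (simp add: powr_def algebra_simps flip: exp_add)
  then have "\<forall>\<^sub>F n::nat in sequentially. (2 powr real n + real n) * exp (- real n) < \<delta>"
    using \<open>0 < \<delta>\<close> by (rule order_tendstoD)
  moreover have "\<forall>\<^sub>F n::nat in sequentially. exp 2 \<le> real n powr (\<epsilon> / 2)"
    using \<open>0 < \<epsilon>\<close> by real_asymp
  ultimately have "\<forall>\<^sub>F n::nat in sequentially. exp 2 \<le> real n powr (\<epsilon> / 2) \<and>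
      (2 powr real n + real n) * exp (- real n) < \<delta> \<and> 0 < n"
    using eventually_gt_at_top[of 0] by eventually_elim simp
  then obtain N where N: "\<And>n. N \<le> n \<Longrightarrow> exp 2 \<le> real n powr (\<epsilon> / 2) \<and>
      (2 powr real n + real n) * exp (- real n) < \<delta> \<and> 0 < n"
    unfolding eventually_sequentially by blast
  have "\<exists>v. XOS_instance n (n ^ 3) v \<and>
          (\<exists>T\<in>set_pmf R. 2 powr (1 * real n) \<le> real (num_queries T v))"
    if "N \<le> n" and R: "solves p (1 / real n powr (1 - \<epsilon>)) \<delta> n (n ^ 3) R" for n R
  proof (rule ccontr)
    assume neg: "\<not> ?thesis"
    \<comment> \<open>With \<open>a * n = y\<close>, the unplanted welfare is at most
      \<open>n * (1 + y)\<close>, while \<open>\<alpha>\<close> times the hidden welfare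
      \<open>n * n\<close> is \<open>n * (y * y)\<close>. Splitting \<open>\<epsilon>\<close> in
      halves leaves the factor \<open>y\<close> both for the tail bound and for the gap.\<close>
    define y where "y = real n powr (\<epsilon> / 2)"
    define a where "a = y / real n"
    define \<alpha> where "\<alpha> = 1 / real n powr (1 - \<epsilon>)"
    let ?l = "n\<^sup>2" and ?m = "n ^ 3"
    let ?H = "{..<?l} \<rightarrow>\<^sub>E {..<n}"
    have n: "0 < n" and y: "exp 2 \<le> y" and small: "(2 powr real n + real n) * exp (- real n) < \<delta>"
      using N[OF \<open>N \<le> n\<close>] by (auto simp: y_def)
    have "card ({..<?l} \<times> {..<n}) = card {1..?m}"
      by (simp add: card_cartesian_product power3_eq_cube power2_eq_square)
    then obtain e where e: "bij_betw e ({..<?l} \<times> {..<n}) {1..?m}"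
      using finite_same_card_bij[of "{..<?l} \<times> {..<n}" "{1..?m}"] by auto
    define w where "w h i = planted n a (hidden_bundle e ?l n h i)" for h i
    have "0 \<le> a" by (simp add: a_def y_def)
    have "y * y = real n powr \<epsilon>" by (simp add: y_def flip: powr_add)
    moreover have "real n powr (1 - \<epsilon>) * real n powr \<epsilon> = real n"
      using n by (simp flip: powr_add)
    ultimately have "\<alpha> * real ?l = real n * (y * y)"
      using n by (simp add: \<alpha>_def power2_eq_square divide_eq_eq mult.commute)
    moreover have "3 \<le> y" using y exp_ge_add_one_self[of "2::real"] by linarith
    then have "3 * y \<le> y * y" by (intro mult_right_mono) auto
    then have "1 + y < y * y" using \<open>3 \<le> y\<close> by linarith
    then have "real n * (1 + y) < real n * (y * y)" using n by simp
    moreover have "real n + a * real ?m / real n = real n * (1 + y)"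
      using n by (simp add: a_def power3_eq_cube field_simps)
    ultimately have gap: "real n + a * real ?m / real n < \<alpha> * real ?l" by simp
    have finH: "finite ?H" and "0 < card ?H"
      using n by (auto simp: card_PiE intro: finite_PiE)
    have "\<delta> \<le> measure_pmf.prob R {T. approx_optimal p \<alpha> n ?m (w h) (result T (w h))}" for h
      using R planted_XOS_instance[OF \<open>0 \<le> a\<close>] unfolding solves_def w_def \<alpha>_def by blast
    \<comment> \<open>Double counting of successful pairs of tree and shift: correctness bounds the
      sum from below, the single-tree count from above.\<close>
    then have "(\<Sum>h\<in>?H. \<delta>)
        \<le> (\<Sum>h\<in>?H. measure_pmf.prob R {T. approx_optimal p \<alpha> n ?m (w h) (result T (w h))})"
      by (intro sum_mono)
    also have "\<dots> \<le> (2 powr real n + real n) * (exp (- real n) * real (card ?H))"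
    proof (rule sum_prob_pmf_le[OF finH])
      fix T assume T: "T \<in> set_pmf R"
      \<comment> \<open>The unplanted instance is the witness for many queries: the negated claim,
        applied to it, bounds the queries of every tree in the support.\<close>
      have "XOS_instance n ?m (\<lambda>_. planted n a {})"
        using planted_XOS_instance[OF \<open>0 \<le> a\<close>] .
      then have few: "real (num_queries T (\<lambda>_. planted n a {})) \<le> 2 powr real n"
        using neg T by fastforce
      have "real (card {h\<in>?H. approx_optimal p \<alpha> n ?m (w h) (result T (w h))})
          \<le> (real (num_queries T (\<lambda>_. planted n a {})) + real n)
             * (exp (- real n) * real (card ?H))"
        unfolding w_def
      proof (rule card_successful_shifts_le[OF e n _ \<open>p \<le> 1\<close> _ gap])
        show "wf_alg n ?m T" using R T by (simp add: solves_def)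
      qed (use n y in \<open>auto simp: a_def \<alpha>_def\<close>)
      also have "\<dots> \<le> (2 powr real n + real n) * (exp (- real n) * real (card ?H))"
        using few by (intro mult_right_mono) auto
      finally show "real (card {h\<in>?H. approx_optimal p \<alpha> n ?m (w h) (result T (w h))})
          \<le> (2 powr real n + real n) * (exp (- real n) * real (card ?H))" .
    qed
    finally have "real (card ?H) * \<delta> \<le> real (card ?H) * ((2 powr real n + real n) * exp (- real n))"
      by (simp add: mult_ac)
    then show False using small \<open>0 < card ?H\<close> by simp
  qed
  then have lower_bound: "\<exists>m\<le>n ^ 3. \<forall>R. solves p (1 / real n powr (1 - \<epsilon>)) \<delta> n m R \<longrightarrow>
      (\<exists>v. XOS_instance n m v \<and> (\<exists>T\<in>set_pmf R. 2 powr (1 * real n) \<le> real (num_queries T v)))"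
    if "N \<le> n" for n
    using that by (intro exI[of _ "n ^ 3"] conjI allI impI order_refl)
  show ?thesis
    by (rule exI[of _ 1], rule conjI[OF zero_less_one], rule exI[of _ 3], rule exI[of _ N],
        intro allI impI lower_bound)
qed

end
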